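(* Let $Z_1,Z_2,Z_3\in\mathbb R^2$ be the vertices of a (nondegenerate) triangle and let $d_1,d_2,d_3>0$. Then the minimization problem of minimizing $$O(W)=\sum_{j=1}^3\left|\,\|W-Z_j\|^2-d_j^2\right|$$ over $W\in\mathbb R^2$ has at most five solutions, i.e. the set of global minimizers of $O$ has at most $5$ elements.
   Context: $\|\cdot\|$ is the Euclidean norm on $\mathbb R^2$. *)

theory Defs
  imports "HOL-Analysis.Analysis"
begin

definition obj :: "(nat \<Rightarrow> real ^ 2) \<Rightarrow> (nat \<Rightarrow> real) \<Rightarrow> real ^ 2 \<Rightarrow> real" where
  "obj Z d W = (\<Sum>j = 1..3. \<bar>(norm (W - Z j))\<^sup>2 - (d j)\<^sup>2\<bar>)"

end

theory Submission
  imports Defs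
begin

text \<open>Writing \<open>f\<^sub>j W = \<parallel>W - Z\<^sub>j\<parallel>\<^sup>2 - d\<^sub>j\<^sup>2\<close>, the map \<open>W \<mapsto> (f\<^sub>1 W, f\<^sub>2 W, f\<^sub>3 W)\<close> is injective and
  its image is an elliptic paraboloid in \<open>\<real>\<^sup>3\<close> with axis direction \<open>(1,1,1)\<close>. The minimizers of the
  objective correspond to the contact points of this paraboloid with the smallest octahedron
  (\<open>\<ell>\<^sup>1\<close>-ball around the origin) that meets it. If the origin lies outside the convex region bounded
  by the paraboloid, strict convexity leaves only one contact point. Otherwise the octahedron is
  inscribed in that region, so by strict convexity it touches the paraboloid in some of its six
  vertices. It cannot touch in all six: on the paraboloid's equation, the contributions of
  opposite vertices differ by a linear function of the vertex, and summing over the three axes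
  contradicts that this function is nonzero on \<open>(1,1,1)\<close>.\<close>

section \<open>Extreme points of the octahedron\<close>

fun norm1 :: "real \<times> real \<times> real \<Rightarrow> real" where
  "norm1 (x, y, z) = \<bar>x\<bar> + \<bar>y\<bar> + \<bar>z\<bar>"

definition octahedron_vertices :: "real \<Rightarrow> (real \<times> real \<times> real) set" where
  "octahedron_vertices m =
    {(m, 0, 0), (0, m, 0), (0, 0, m), (- m, 0, 0), (0, - m, 0), (0, 0, - m)}"

lemma norm1_scaleR: "norm1 (s *\<^sub>R b) = \<bar>s\<bar> * norm1 b"
  by (cases b) (simp add: abs_mult algebra_simps)

lemma norm1_nonpos: "norm1 b \<le> 0 \<Longrightarrow> b = 0"
  by (cases b) (auto simp: zero_prod_def)

lemma norm1_midpoint_le: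
  assumes "norm1 b \<le> m" "norm1 c \<le> m"
  shows "norm1 ((1/2) *\<^sub>R (b + c)) \<le> m"
proof -
  have "norm1 (b + c) \<le> norm1 b + norm1 c"
    by (cases b; cases c) auto
  then show ?thesis
    using assms by (simp add: norm1_scaleR del: scaleR_add_right)
qed

text \<open>A non-vertex has two nonzero coordinates, so it can be shifted both ways inside a
  coordinate plane without leaving the ball. Such a \<open>v\<close> has a zero and a nonzero
  coordinate, hence avoids the diagonal, the only place where \<open>g\<close> may vanish
  later.\<close>

lemma norm1_non_extreme:
  assumes "x \<notin> octahedron_vertices (norm1 x)"
  obtains v where "norm1 (x + v) \<le> norm1 x" "norm1 (x - v) \<le> norm1 x" "\<And>c. v \<noteq> (c, c, c)"
proof -
  obtain a b c where x: "x = (a, b, c)"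
    by (metis prod_cases3)
  have dir: "\<exists>p q. \<bar>a + p\<bar> + \<bar>b + q\<bar> \<le> \<bar>a\<bar> + \<bar>b\<bar> \<and> \<bar>a - p\<bar> + \<bar>b - q\<bar> \<le> \<bar>a\<bar> + \<bar>b\<bar> \<and> p \<noteq> 0"
    if "a \<noteq> 0" "b \<noteq> 0" for a b :: real
  proof -
    \<comment> \<open>One absolute value grows by \<open>e\<close> while the other shrinks by
      \<open>e\<close>; as \<open>e\<close> exceeds neither, no sign changes.\<close>
    define e where "e = min \<bar>a\<bar> \<bar>b\<bar>"
    have e: "0 < e" "e \<le> \<bar>a\<bar>" "e \<le> \<bar>b\<bar>"
      using that by (auto simp: e_def)
    show ?thesis
      using e that
      by (intro exI[of _ "if a > 0 then e else - e"] exI[of _ "if b > 0 then - e else e"])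
        (auto simp: abs_if split: if_splits)
  qed
  have "a \<noteq> 0 \<and> b \<noteq> 0 \<or> a \<noteq> 0 \<and> c \<noteq> 0 \<or> b \<noteq> 0 \<and> c \<noteq> 0"
    using assms by (auto simp: x octahedron_vertices_def abs_if split: if_splits)
  then consider "a \<noteq> 0" "b \<noteq> 0" | "a \<noteq> 0" "c \<noteq> 0" | "b \<noteq> 0" "c \<noteq> 0"
    by blast
  then show thesis
  proof cases
    case 1
    then obtain p q where "\<bar>a + p\<bar> + \<bar>b + q\<bar> \<le> \<bar>a\<bar> + \<bar>b\<bar>" "\<bar>a - p\<bar> + \<bar>b - q\<bar> \<le> \<bar>a\<bar> + \<bar>b\<bar>" "p \<noteq> 0"
      using dir by blast
    then show thesis
      by (intro that[of "(p, q, 0)"]) (auto simp: x)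
  next
    case 2
    then obtain p q where "\<bar>a + p\<bar> + \<bar>c + q\<bar> \<le> \<bar>a\<bar> + \<bar>c\<bar>" "\<bar>a - p\<bar> + \<bar>c - q\<bar> \<le> \<bar>a\<bar> + \<bar>c\<bar>" "p \<noteq> 0"
      using dir by blast
    then show thesis
      by (intro that[of "(p, 0, q)"]) (auto simp: x)
  next
    case 3
    then obtain p q where "\<bar>b + p\<bar> + \<bar>c + q\<bar> \<le> \<bar>b\<bar> + \<bar>c\<bar>" "\<bar>b - p\<bar> + \<bar>c - q\<bar> \<le> \<bar>b\<bar> + \<bar>c\<bar>" "p \<noteq> 0"
      using dir by blast
    then show thesis
      by (intro that[of "(0, p, q)"]) (auto simp: x)
  qed
qed

section \<open>Contact of the paraboloid with the octahedron\<close>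

locale paraboloid =
  fixes l :: "real \<times> real \<times> real \<Rightarrow> real"
    and g :: "real \<times> real \<times> real \<Rightarrow> 'w::real_inner"
    and t :: real
  assumes linear_l: "linear l"
    and linear_g: "linear g"
    and l_axis: "l (1, 1, 1) = 1"
    and g_kernel: "g v = 0 \<Longrightarrow> \<exists>c. v = (c, c, c)"
begin

text \<open>The paraboloid is the zero set of \<open>height\<close>; the convex region is where \<open>height\<close> is
  nonnegative.\<close>

definition height :: "real \<times> real \<times> real \<Rightarrow> real" where
  "height b = t + l b - (norm (g b))\<^sup>2"

definition minimizers :: "(real \<times> real \<times> real) set" where
  "minimizers = {b. height b = 0 \<and> (\<forall>c. height c = 0 \<longrightarrow> norm1 b \<le> norm1 c)}"

lemma height_0: "height 0 = t"
  using linear_0[OF linear_l] linear_0[OF linear_g] by (simp add: height_def)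

lemma l_diagonal: "l (c, c, c) = c"
  using linear_scale[OF linear_l, of c "(1, 1, 1)"] l_axis by simp

text \<open>The parallelogram law: this is the concavity of \<open>height\<close>, strict where
  \<open>g (b - c)\<close> is nonzero.\<close>

lemma height_midpoint:
  "height ((1/2) *\<^sub>R (b + c)) = (height b + height c) / 2 + (norm (g (b - c)))\<^sup>2 / 4"
  by (simp add: height_def linear_add[OF linear_l] linear_scale[OF linear_l]
      linear_add[OF linear_g] linear_diff[OF linear_g] linear_scale[OF linear_g]
      power2_norm_eq_inner inner_simps inner_commute field_simps)

lemma height_add_diff:
  "height (x + v) + height (x - v) = 2 * height x - 2 * (norm (g v))\<^sup>2"
  by (simp add: height_def linear_add[OF linear_l] linear_diff[OF linear_l]
      linear_add[OF linear_g] linear_diff[OF linear_g]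
      power2_norm_eq_inner inner_simps inner_commute field_simps)

lemma height_diff_neg: "height b - height (- b) = 2 * l b"
  by (simp add: height_def linear_neg[OF linear_l] linear_neg[OF linear_g])

text \<open>Since \<open>height 0 = t\<close>, a negative product puts \<open>b\<close> and the
  origin on opposite sides, and the intermediate value theorem applies on the segment between
  them.\<close>

lemma height_zero_between:
  assumes "t * height b < 0"
  obtains s where "0 < s" "s < 1" "height (s *\<^sub>R b) = 0"
proof -
  define k where "k s = t * height (s *\<^sub>R b)" for s
  have k: "k s = t * (t + s * l b - s\<^sup>2 * (norm (g b))\<^sup>2)" for s
    by (simp add: k_def height_def linear_scale[OF linear_l] linear_scale[OF linear_g] power_mult_distrib)
  have "t \<noteq> 0"
    using assms by auto
  then have k0: "k 0 > 0"
    by (simp add: k not_sum_squares_lt_zero zero_less_mult_iff) linarith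
  have k1: "k 1 < 0"
    using assms by (simp add: k_def)
  have "continuous_on {0..1} k"
    unfolding k by (intro continuous_intros)
  then obtain s where s: "0 \<le> s" "s \<le> 1" "k s = 0"
    using IVT2'[of k 1 0 0] k0 k1 by auto
  then have "0 < s" "s < 1"
    using k0 k1 by (auto simp: less_le)
  then show thesis
    using that s \<open>t \<noteq> 0\<close> by (simp add: k_def)
qed

text \<open>Otherwise the segment from the origin to \<open>b\<close> would meet the paraboloid at a
  point of norm below \<open>m\<close>. The product with \<open>t\<close> treats both positions of
  the origin at once.\<close>

lemma same_side:
  assumes min: "\<And>c. height c = 0 \<Longrightarrow> m \<le> norm1 c" and "0 < m" and "norm1 b \<le> m"
  shows "0 \<le> t * height b"
proof (rule ccontr)
  assume "\<not> ?thesis"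
  then obtain s where s: "0 < s" "s < 1" "height (s *\<^sub>R b) = 0"
    using height_zero_between[of b] by auto
  have "norm1 (s *\<^sub>R b) \<le> s * m"
    using s assms by (simp add: norm1_scaleR)
  also have "\<dots> < m"
    using s \<open>0 < m\<close> by simp
  finally show False
    using min[OF s(3)] by simp
qed

text \<open>The midpoint of two distinct contact points has positive height by strict concavity and
  lies in the ball, so the origin is on that side too.\<close>

lemma origin_inside:
  assumes min: "\<And>c. height c = 0 \<Longrightarrow> m \<le> norm1 c" and "0 < m"
    and b: "height b = 0" "norm1 b = m" and c: "height c = 0" "norm1 c = m" and "b \<noteq> c"
  shows "0 < t"
proof -
  have "g (b - c) \<noteq> 0"
  proof
    assume g0: "g (b - c) = 0"
    then obtain k where k: "b - c = (k, k, k)"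
      using g_kernel by blast
    \<comment> \<open>On the zero set of \<open>height\<close>, equal \<open>g\<close> forces equal
      \<open>l\<close>, and \<open>l\<close> is injective on the diagonal.\<close>
    have "g b = g c"
      using g0 linear_diff[OF linear_g] by simp
    then have "l (b - c) = 0"
      using b c linear_diff[OF linear_l] by (simp add: height_def)
    then have "b - c = 0"
      using k l_diagonal by (simp add: zero_prod_def)
    then show False
      using \<open>b \<noteq> c\<close> by simp
  qed
  then have "0 < height ((1/2) *\<^sub>R (b + c))"
    using b c by (simp add: height_midpoint)
  moreover have "0 \<le> t * height ((1/2) *\<^sub>R (b + c))"
    using b c by (intro same_side[of m] min \<open>0 < m\<close> norm1_midpoint_le) auto
  moreover have "t \<noteq> 0"
    using min[of 0] height_0 \<open>0 < m\<close> by (auto simp: zero_prod_def)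
  ultimately show ?thesis
    by (simp add: zero_le_mult_iff)
qed

text \<open>At a non-vertex, \<open>x + v\<close> and \<open>x - v\<close> stay in the ball and so
  have nonnegative height, but concavity makes their heights sum to a negative number.\<close>

lemma contact_is_vertex:
  assumes min: "\<And>c. height c = 0 \<Longrightarrow> m \<le> norm1 c" and "0 < m" and "0 < t"
    and x: "height x = 0" "norm1 x = m"
  shows "x \<in> octahedron_vertices m"
proof (rule ccontr)
  assume "x \<notin> octahedron_vertices m"
  then obtain v where v: "norm1 (x + v) \<le> m" "norm1 (x - v) \<le> m" "\<And>c. v \<noteq> (c, c, c)"
    using norm1_non_extreme[of x] x by blast
  then have "g v \<noteq> 0"
    using g_kernel by blast
  then have "height (x + v) + height (x - v) < 0"
    using x by (simp add: height_add_diff)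
  moreover have "0 \<le> t * height (x + v)" "0 \<le> t * height (x - v)"
    using v by (auto intro: same_side[of m] min \<open>0 < m\<close>)
  ultimately show False
    using \<open>0 < t\<close> by (simp add: zero_le_mult_iff)
qed

lemma not_all_vertices:
  assumes "0 < m"
  shows "\<exists>b \<in> octahedron_vertices m. height b \<noteq> 0"
proof (rule ccontr)
  assume "\<not> ?thesis"
  then have "l (m, 0, 0) = 0" "l (0, m, 0) = 0" "l (0, 0, m) = 0"
    using height_diff_neg[of "(m, 0, 0)"] height_diff_neg[of "(0, m, 0)"]
      height_diff_neg[of "(0, 0, m)"]
    by (auto simp: octahedron_vertices_def)
  then have "l ((m, 0, 0) + (0, m, 0) + (0, 0, m)) = 0"
    by (simp only: linear_add[OF linear_l])
  then show False
    using l_diagonal[of m] assms by simp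
qed

lemma card_minimizers: "finite minimizers \<and> card minimizers \<le> 5"
proof (cases "\<exists>b \<in> minimizers. \<exists>c \<in> minimizers. b \<noteq> c")
  case False
  then have "minimizers = {} \<or> (\<exists>b. minimizers = {b})"
    by blast
  then show ?thesis
    by auto
next
  case True
  then obtain b c where bc: "b \<in> minimizers" "c \<in> minimizers" "b \<noteq> c"
    by blast
  define m where "m = norm1 b"
  have norm_m: "norm1 x = m" if "x \<in> minimizers" for x
    unfolding m_def by (rule antisym) (use that bc(1) in \<open>unfold minimizers_def, blast+\<close>)
  have min: "m \<le> norm1 x" if "height x = 0" for x
    using that bc(1) unfolding minimizers_def m_def by blast
  have height0: "height x = 0" if "x \<in> minimizers" for x
    using that by (simp add: minimizers_def)
  have "0 < m"
  proof (rule ccontr)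
    assume "\<not> 0 < m"
    then have "b = 0" "c = 0"
      using norm_m[OF bc(1)] norm_m[OF bc(2)] by (simp_all add: norm1_nonpos)
    then show False
      using bc by simp
  qed
  have "0 < t"
    using origin_inside[OF min \<open>0 < m\<close>] bc norm_m height0 by blast
  then have "minimizers \<subseteq> octahedron_vertices m"
    using contact_is_vertex[OF min \<open>0 < m\<close>] norm_m height0 by blast
  moreover have "minimizers \<noteq> octahedron_vertices m"
    using not_all_vertices[OF \<open>0 < m\<close>] height0 by blast
  moreover have fin: "finite (octahedron_vertices m)"
    by (simp add: octahedron_vertices_def)
  ultimately have "card minimizers < card (octahedron_vertices m)" "finite minimizers"
    by (auto intro: psubset_card_mono finite_subset)
  \<comment> \<open>Passing to a list bounds the cardinality by its length, with no need to check
    distinctness.\<close>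
  moreover have "card (octahedron_vertices m) \<le> card (set [(m, 0, 0), (0, m, 0), (0, 0, m), (- m, 0, 0), (0, - m, 0), (0, 0, - m)])"
    by (simp add: octahedron_vertices_def)
  moreover have "\<dots> \<le> 6"
    by (rule order_trans[OF card_length]) simp
  ultimately show ?thesis
    by linarith
qed

end

section \<open>From the triangle to the paraboloid\<close>

lemma dual_basis_plane:
  fixes p q :: "real ^ 2"
  assumes "\<not> collinear {0, p, q}"
  obtains p' q' where "p \<bullet> p' = 1" "q \<bullet> p' = 0" "p \<bullet> q' = 0" "q \<bullet> q' = 1"
    "\<And>w. w = (p \<bullet> w) *\<^sub>R p' + (q \<bullet> w) *\<^sub>R q'"
proof -
  define D where "D = p$1 * q$2 - p$2 * q$1"
  have "D \<noteq> 0"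
  proof
    assume D: "D = 0"
    have "collinear {0, p, q}"
    proof (cases "p = 0")
      case False
      then have "p$1 \<noteq> 0 \<or> p$2 \<noteq> 0"
        by (auto simp: vec_eq_iff forall_2)
      then have "q = (if p$1 = 0 then q$2 / p$2 else q$1 / p$1) *\<^sub>R p"
        using D by (auto simp: vec_eq_iff forall_2 D_def field_simps)
      then show ?thesis
        by (subst collinear_lemma) metis
    qed (simp add: collinear_lemma)
    then show False
      using assms by simp
  qed
  show thesis
  \<comment> \<open>Cramer's rule: the columns of the inverse of the matrix with rows
    \<open>p\<close> and \<open>q\<close>.\<close>
  proof (rule that[of "vector [q$2 / D, - q$1 / D]" "vector [- p$2 / D, p$1 / D]"])
    show "w = (p \<bullet> w) *\<^sub>R vector [q$2 / D, - q$1 / D] + (q \<bullet> w) *\<^sub>R vector [- p$2 / D, p$1 / D]"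
      for w
      using \<open>D \<noteq> 0\<close>
      by (simp add: vec_eq_iff forall_2 inner_vec_def sum_2 divide_simps)
        (simp add: D_def algebra_simps)
  qed (use \<open>D \<noteq> 0\<close> in \<open>simp_all add: inner_vec_def sum_2 divide_simps\<close>, simp_all add: D_def)
qed

theorem theorem2:
  fixes Z :: "nat \<Rightarrow> real ^ 2" and d :: "nat \<Rightarrow> real"
  assumes "\<not> collinear {Z 1, Z 2, Z 3}"
    and "d 1 > 0" and "d 2 > 0" and "d 3 > 0"
  shows "finite {W. is_arg_min (obj Z d) (\<lambda>_. True) W} \<and>
    card {W. is_arg_min (obj Z d) (\<lambda>_. True) W} \<le> 5"
proof -
  define f where "f j W = (norm (W - Z j))\<^sup>2 - (d j)\<^sup>2" for j W
  define F where "F W = (f 1 W, f 2 W, f 3 W)" for W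
  have obj: "obj Z d W = norm1 (F W)" for W
    by (simp add: obj_def F_def f_def numeral_3_eq_3 numeral_2_eq_2)
  \<comment> \<open>The gradients of the affine functions \<open>f 1 - f 2\<close> and
    \<open>f 1 - f 3\<close>.\<close>
  define p q where "p = 2 *\<^sub>R (Z 2 - Z 1)" and "q = 2 *\<^sub>R (Z 3 - Z 1)"
  have "\<not> collinear {0, p, q}"
  proof
    assume "collinear {0, p, q}"
    moreover have "q = c *\<^sub>R p \<longleftrightarrow> Z 3 - Z 1 = c *\<^sub>R (Z 2 - Z 1)" for c
      by (simp add: p_def q_def scaleR_left_commute[of c] del: scaleR_scaleR)
    ultimately have "collinear {0, Z 2 - Z 1, Z 3 - Z 1}"
      by (simp add: collinear_lemma) (simp add: p_def q_def)
    then have "collinear {Z 2, Z 1, Z 3}"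
      by (simp add: collinear_3)
    then show False
      using assms by (simp add: insert_commute)
  qed
  then obtain p' q' where dual: "p \<bullet> p' = 1" "q \<bullet> p' = 0" "p \<bullet> q' = 0" "q \<bullet> q' = 1"
    and decomp: "\<And>w. w = (p \<bullet> w) *\<^sub>R p' + (q \<bullet> w) *\<^sub>R q'"
    using dual_basis_plane by blast
  \<comment> \<open>\<open>g b\<close> is the displacement whose inner products with
    \<open>p\<close> and \<open>q\<close> are the coordinate differences of \<open>b\<close>; thus
    \<open>g\<close> recovers \<open>W - W0\<close> from \<open>F W\<close>.\<close>
  define g :: "real \<times> real \<times> real \<Rightarrow> real ^ 2"
    where "g = (\<lambda>(x, y, z). (x - y) *\<^sub>R p' + (x - z) *\<^sub>R q')"
  have f_diff: "f 1 (W + w) - f 2 (W + w) = f 1 W - f 2 W + p \<bullet> w"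
    "f 1 (W + w) - f 3 (W + w) = f 1 W - f 3 W + q \<bullet> w" for W w
    by (simp_all add: f_def p_def q_def power2_norm_eq_inner inner_simps inner_commute algebra_simps)
  text \<open>The radical center of the three circles.\<close>
  define W0 where "W0 = - g (F 0)"
  have W0: "f 1 W0 = f 2 W0" "f 1 W0 = f 3 W0"
    using f_diff[of 0 W0] dual by (simp_all add: W0_def g_def F_def inner_simps)
  \<comment> \<open>Chosen so that expanding \<open>f 1 (W0 + g b)\<close> around \<open>W0\<close>
    gives \<open>fst b - height b\<close>.\<close>
  define l where "l b = fst b - 2 * ((W0 - Z 1) \<bullet> g b)" for b
  have lin_g: "linear g"
    by (rule linearI) (auto simp: g_def algebra_simps)
  have lin_l: "linear l"
    by (rule linearI) (auto simp: l_def linear_add[OF lin_g] linear_scale[OF lin_g] inner_simps algebra_simps)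
  interpret paraboloid l g "- f 1 W0"
  proof (rule paraboloid.intro)
    show "\<exists>c. v = (c, c, c)" if "g v = 0" for v
    proof -
      obtain x y z where v: "v = (x, y, z)"
        by (metis prod_cases3)
      have "p \<bullet> g v = x - y" "q \<bullet> g v = x - z"
        by (simp_all add: v g_def inner_simps dual)
      then show ?thesis
        using that v by simp
    qed
    show "l (1, 1, 1) = 1"
      by (simp add: l_def g_def)
  qed (fact lin_l lin_g)+
  \<comment> \<open>Going to the plane and back moves \<open>b\<close> only along the axis, by
    \<open>height b\<close>; hence the image of \<open>F\<close> is exactly the zero set of
    \<open>height\<close>.\<close>
  have F_param: "F (W0 + g b) = b - (height b, height b, height b)" for b
  proof -
    obtain x y z where b: "b = (x, y, z)"
      by (metis prod_cases3)
    have "f 1 (W0 + g b) = x - height b"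
      unfolding height_def
      by (simp add: f_def l_def b power2_norm_eq_inner inner_simps inner_commute)
    moreover have "p \<bullet> g b = x - y" "q \<bullet> g b = x - z"
      by (simp_all add: b g_def inner_simps dual)
    ultimately show ?thesis
      using f_diff[of W0 "g b"] W0 by (simp add: F_def b)
  qed
  have g_F: "W0 + g (F W) = W" for W
  proof -
    have "g (F W) = (p \<bullet> (W - W0)) *\<^sub>R p' + (q \<bullet> (W - W0)) *\<^sub>R q'"
      using f_diff[of W0 "W - W0"] W0 by (simp add: g_def F_def)
    also have "\<dots> = W - W0"
      using decomp[of "W - W0"] by simp
    finally show ?thesis
      by simp
  qed
  have height_F: "height (F W) = 0" for W
    using F_param[of "F W"] unfolding g_F by (simp add: prod_eq_iff)
  have F_surj: "\<exists>W. F W = b" if "height b = 0" for b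
    using F_param[of b] that by (auto simp: prod_eq_iff)
  have "inj F"
    by (rule injI) (metis g_F)
  have "F W \<in> minimizers" if "is_arg_min (obj Z d) (\<lambda>_. True) W" for W
    unfolding minimizers_def
  proof (intro CollectI conjI allI impI)
    fix c
    assume "height c = 0"
    then obtain V where "F V = c"
      using F_surj by blast
    then show "norm1 (F W) \<le> norm1 c"
      using that unfolding is_arg_min_linorder obj by blast
  qed (rule height_F)
  then have sub: "F ` {W. is_arg_min (obj Z d) (\<lambda>_. True) W} \<subseteq> minimizers"
    by blast
  then have "finite {W. is_arg_min (obj Z d) (\<lambda>_. True) W}"
    using card_minimizers \<open>inj F\<close> by (meson finite_imageD finite_subset inj_on_subset subset_UNIV)
  moreover have "card {W. is_arg_min (obj Z d) (\<lambda>_. True) W} \<le> card minimizers"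
    using card_minimizers \<open>inj F\<close> sub by (meson card_inj_on_le inj_on_subset subset_UNIV)
  ultimately show ?thesis
    using card_minimizers by linarith
qed

end
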